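(* For a nonnegative integer $n$, let (i) $K_1(n)$ be the number of partitions of $n$ into parts congruent to $1,17,32,34,36,51$ or $67 \pmod{68}$, where parts congruent to $1,17,51$ or $67 \pmod{68}$ come in $2$ colors, parts congruent to $34 \pmod{68}$ come in $2$ colors, and parts congruent to $32$ or $36 \pmod{68}$ have $1$ color; (ii) $K_2(n)$ be the number of partitions of $n$ into parts congruent to $17,32,33,34,35,36$ or $51 \pmod{68}$, where parts congruent to $17,33,35$ or $51 \pmod{68}$ come in $2$ colors, parts congruent to $34 \pmod{68}$ come in $2$ colors, and parts congruent to $32$ or $36 \pmod{68}$ have $1$ color; (iii) $K_3(n)$ be the number of partitions of $n$ into parts congruent to $1,16,18,33,35,50,52$ or $67 \pmod{68}$, where parts congruent to $1,33,35$ or $67 \pmod{68}$ come in $2$ colors and the other parts have $1$ color. (Here $K_1(0)=K_2(0)=K_3(0)=1$.) Then for every integer $n\ge 16$, \[ K_1(n)+K_2(n-16)=K_3(n). \]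
   Context: A part size class that "comes in $r$ colors" means each part of that class is labeled with one of $r$ distinct colors, partitions being counted as multisets of colored parts. Equivalently $\sum_n K_1(n)q^n=1/\big((q^{32},q^{36};q^{68})_\infty(q^{34};q^{68})_\infty^2(q,q^{17},q^{51},q^{67};q^{68})_\infty^2\big)$, $\sum_n K_2(n)q^n=1/\big((q^{32},q^{36};q^{68})_\infty(q^{34};q^{68})_\infty^2(q^{17},q^{33},q^{35},q^{51};q^{68})_\infty^2\big)$, $\sum_n K_3(n)q^n=1/\big((q^{16},q^{18},q^{50},q^{52};q^{68})_\infty(q,q^{33},q^{35},q^{67};q^{68})_\infty^2\big)$, where $(\lambda;q)_\infty=\prod_{n\ge0}(1-\lambda q^n)$. *)

theory Defs
  imports Complex_Main "HOL-Library.Multiset"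
begin

(* A coloured partition of n is a finite multiset of coloured parts (m, c) whose sizes m add up
   to n. The number r m says in how many colours the part size m comes: the colours of m
   are 0, ..., r m - 1, so r m = 0 means that m is not allowed as a part. *)

definition colored_partitions :: "(nat \<Rightarrow> nat) \<Rightarrow> nat \<Rightarrow> (nat \<times> nat) multiset set" where
  "colored_partitions r n =
     {P. (\<forall>(m, c) \<in># P. 0 < m \<and> c < r m) \<and> (\<Sum>(m, c) \<in># P. m) = n}"

definition colors1 :: "nat \<Rightarrow> nat" where
  "colors1 m =
     (if m mod 68 \<in> {1, 17, 51, 67} then 2
      else if m mod 68 = 34 then 2
      else if m mod 68 \<in> {32, 36} then 1
      else 0)"

definition colors2 :: "nat \<Rightarrow> nat" where
  "colors2 m =
     (if m mod 68 \<in> {17, 33, 35, 51} then 2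
      else if m mod 68 = 34 then 2
      else if m mod 68 \<in> {32, 36} then 1
      else 0)"

definition colors3 :: "nat \<Rightarrow> nat" where
  "colors3 m =
     (if m mod 68 \<in> {1, 33, 35, 67} then 2
      else if m mod 68 \<in> {16, 18, 50, 52} then 1
      else 0)"

definition K1 :: "nat \<Rightarrow> nat" where
  "K1 n = card (colored_partitions colors1 n)"

definition K2 :: "nat \<Rightarrow> nat" where
  "K2 n = card (colored_partitions colors2 n)"

definition K3 :: "nat \<Rightarrow> nat" where
  "K3 n = card (colored_partitions colors3 n)"

(* The cardinalities above are genuine counts: the sets are finite. *)

lemma finite_colored_partitions: "finite (colored_partitions r n)"
proof -
  let ?A = "SIGMA m:{1..n}. {..<r m}"
  let ?B = "{xs. set xs \<subseteq> ?A \<and> length xs \<le> n}"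
  have "finite ?B"
    by (intro finite_lists_length_le finite_SigmaI) auto
  moreover have "colored_partitions r n \<subseteq> mset ` ?B"
  proof
    fix P assume P: "P \<in> colored_partitions r n"
    have pos: "0 < fst x \<and> snd x < r (fst x)" if "x \<in># P" for x
      using P that by (auto simp: colored_partitions_def)
    have sum: "(\<Sum>x \<in># P. fst x) = n"
      using P by (simp add: colored_partitions_def case_prod_unfold)
    have "size P = (\<Sum>x \<in># P. 1)"
      by simp
    also have "\<dots> \<le> (\<Sum>x \<in># P. fst x)"
      using pos by (intro sum_mset_mono) (auto simp: Suc_le_eq)
    finally have size: "size P \<le> n"
      using sum by simp
    have le: "fst x \<le> n" if "x \<in># P" for x
      using sum multi_member_split[OF that] by auto
    obtain xs where xs: "P = mset xs"
      by (metis ex_mset)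
    have "x \<in> ?A" if "x \<in> set xs" for x
      using pos[of x] le[of x] that by (cases x) (simp add: xs Suc_le_eq)
    then have "xs \<in> ?B"
      using size by (auto simp: xs)
    then show "P \<in> mset ` ?B"
      using xs by blast
  qed
  ultimately show ?thesis
    by (meson finite_imageI finite_subset)
qed

lemma colored_partitions_0: "colored_partitions r 0 = {{#}}"
proof -
  have "P = {#}" if P: "P \<in> colored_partitions r 0" for P
  proof (cases P)
    case (add x Q)
    then show ?thesis
      using P by (cases x) (simp add: colored_partitions_def)
  qed simp
  then show ?thesis
    by (auto simp: colored_partitions_def)
qed

lemma K_0: "K1 0 = 1" "K2 0 = 1" "K3 0 = 1"
  by (simp_all add: K1_def K2_def K3_def colored_partitions_0)

end

theory Submission
  imports Defs "HOL-Analysis.Infinite_Sum" "HOL-Analysis.Infinite_Products" "HOL-Analysis.Uniform_Limit"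
begin

text \<open>
  Write \<open>[a]\<close> for the product \<open>(q\<^sup>a, q\<^sup>6\<^sup>8\<^sup>-\<^sup>a; q\<^sup>6\<^sup>8)\<^sub>\<infinity>\<close>. Clearing denominators in the generating functions,
  the claim becomes \<open>[34] [32] [17]\<^sup>2 - [33]\<^sup>2 [18] [16] = q\<^sup>1\<^sup>6 [1]\<^sup>2 [18] [16]\<close>, which is the three-term
  relation for theta functions at \<open>x = q\<^sup>3\<^sup>3\<close>, \<open>y = q\<close>, \<open>u = q\<^sup>1\<^sup>7\<close>, \<open>v = 1\<close>. By the Jacobi triple product
  and a splitting of the double series by parity, \<open>\<theta>(x y) \<theta>(x / y)\<close> is, up to a factor \<open>c x\<close>, a
  \<open>2 \<times> 2\<close> determinant in a vector depending on \<open>x\<close> and a vector depending on \<open>y\<close>, so the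
  three-term relation is the Pluecker relation. All of this is done for real \<open>0 < q < 1\<close>, where the
  generating functions converge and determine their coefficients.
\<close>

subsection \<open>Generating functions of coloured partitions\<close>

text \<open>Real summability is absolute, so the double family is absolutely summable and may be
  summed one coordinate at a time.\<close>

lemma has_sum_Times_mult:
  fixes f :: "'a \<Rightarrow> real" and g :: "'b \<Rightarrow> real"
  assumes "(f has_sum s) A" "(g has_sum t) B"
  shows "((\<lambda>(x, y). f x * g y) has_sum (s * t)) (A \<times> B)"
proof -
  have f: "(\<lambda>x. norm (f x)) summable_on A" and g: "(\<lambda>x. norm (g x)) summable_on B"
    using assms has_sum_imp_summable summable_on_iff_abs_summable_on_real by blast+
  have "(\<lambda>z. norm (case z of (x, y) \<Rightarrow> f x * g y)) summable_on A \<times> B"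
  proof (rule iffD2[OF Infinite_Sum.abs_summable_on_Sigma_iff], intro conjI ballI)
    show "(\<lambda>y. norm (case (x, y) of (x, y) \<Rightarrow> f x * g y)) summable_on B" for x
      using summable_on_cmult_right[OF g, of "norm (f x)"] by (simp add: abs_mult)
    have "(\<Sum>\<^sub>\<infinity>y\<in>B. norm (case (x, y) of (x, y) \<Rightarrow> f x * g y)) =
        norm (f x) * (\<Sum>\<^sub>\<infinity>y\<in>B. norm (g y))" for x
      by (simp add: abs_mult infsum_cmult_right')
    then show "(\<lambda>x. norm (\<Sum>\<^sub>\<infinity>y\<in>B. norm (case (x, y) of (x, y) \<Rightarrow> f x * g y))) summable_on A"
      using summable_on_cmult_left[OF f, of "norm (\<Sum>\<^sub>\<infinity>y\<in>B. norm (g y))"]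
      by (simp add: abs_mult)
  qed
  then have "(\<lambda>(x, y). f x * g y) summable_on A \<times> B"
    by (rule abs_summable_summable)
  then show ?thesis
    by (intro has_sum_SigmaI[where g = "\<lambda>x. f x * t"])
      (use assms in \<open>auto intro!: has_sum_cmult_left has_sum_cmult_right\<close>)
qed

text \<open>A multiset over \<open>insert s S\<close> is a multiplicity of \<open>s\<close> together
  with a multiset over \<open>S\<close>, so each new element contributes a geometric series. This is
  the Euler product for finitely many coloured parts.\<close>

lemma has_sum_prod_mset_geometric:
  fixes f :: "'a \<Rightarrow> real"
  assumes "finite S" "\<And>x. x \<in> S \<Longrightarrow> 0 \<le> f x" "\<And>x. x \<in> S \<Longrightarrow> f x < 1"
  shows "((\<lambda>P. \<Prod>x\<in>#P. f x) has_sum (\<Prod>x\<in>S. 1 / (1 - f x))) {P. set_mset P \<subseteq> S}"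
  using assms
proof (induction S rule: finite_induct)
  case empty
  have "{P. set_mset P \<subseteq> {}} = {{#}}"
    by auto
  then show ?case
    by (simp add: has_sum_finite_iff)
next
  case (insert s S)
  have "((\<lambda>k. f s ^ k) has_sum (1 / (1 - f s))) UNIV"
    using geometric_sums[of "f s"] insert.prems by (intro sums_nonneg_imp_has_sum) auto
  from has_sum_Times_mult[OF this insert.IH]
  have "((\<lambda>(k, P). f s ^ k * (\<Prod>x\<in>#P. f x)) has_sum
      (1 / (1 - f s) * (\<Prod>x\<in>S. 1 / (1 - f x)))) (UNIV \<times> {P. set_mset P \<subseteq> S})"
    using insert.prems by auto
  also have "?this \<longleftrightarrow> ((\<lambda>P. \<Prod>x\<in>#P. f x) has_sum
      (1 / (1 - f s) * (\<Prod>x\<in>S. 1 / (1 - f x)))) {P. set_mset P \<subseteq> insert s S}"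
  proof (rule has_sum_reindex_bij_witness[where
        j = "\<lambda>(k, P). replicate_mset k s + P" and
        i = "\<lambda>P. (count P s, filter_mset (\<lambda>x. x \<noteq> s) P)"])
    fix a :: "nat \<times> 'a multiset"
    assume a: "a \<in> UNIV \<times> {P. set_mset P \<subseteq> S}"
    obtain k P where aeq: "a = (k, P)" by (cases a)
    have sP: "s \<notin># P"
      using a aeq insert.hyps by auto
    then have *: "filter_mset (\<lambda>x. x \<noteq> s) P = P"
      by (auto simp: filter_mset_eq_conv)
    show "(\<lambda>P. (count P s, filter_mset (\<lambda>x. x \<noteq> s) P)) ((\<lambda>(k, P). replicate_mset k s + P) a) = a"
      using sP * by (auto simp: aeq not_in_iff)
    show "(\<lambda>(k, P). replicate_mset k s + P) a \<in> {P. set_mset P \<subseteq> insert s S}"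
      using a by (auto simp: aeq split: if_splits)
    show "(\<Prod>x\<in>#(\<lambda>(k, P). replicate_mset k s + P) a. f x) =
        (case a of (k, P) \<Rightarrow> f s ^ k * (\<Prod>x\<in>#P. f x))"
      by (simp add: aeq)
  next
    fix P :: "'a multiset"
    assume P: "P \<in> {P. set_mset P \<subseteq> insert s S}"
    show "(\<lambda>(k, P). replicate_mset k s + P) (count P s, filter_mset (\<lambda>x. x \<noteq> s) P) = P"
      by (rule multiset_eqI) auto
    show "(count P s, filter_mset (\<lambda>x. x \<noteq> s) P) \<in> UNIV \<times> {P. set_mset P \<subseteq> S}"
      using P by auto
  qed simp
  finally show ?case
    using insert.hyps by simp
qed

lemma prod_mset_power:
  "(\<Prod>x\<in>#P. q ^ f x) = (q :: 'a :: comm_monoid_mult) ^ (\<Sum>x\<in>#P. f x)"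
  by (induction P) (simp_all add: power_add)

text \<open>Finite Euler products squeeze the sum. Finitely many partitions use bounded part sizes,
  so they contribute at most \<open>1 / G (d * n)\<close> for all large \<open>n\<close>; conversely
  each \<open>1 / G N\<close> is the sum over a subset of \<open>M\<close>. Cutting at multiples of
  \<open>d\<close> suits a periodic \<open>r\<close>, and \<open>r 0 = 0\<close> keeps the zero
  factor \<open>1 - q ^ 0\<close> out.\<close>

lemma sums_card_colored_partitions:
  fixes q L :: real
  assumes q: "0 < q" "q < 1" and r0: "r 0 = 0" and d: "0 < d" and L: "0 < L"
    and lim: "(\<lambda>N. \<Prod>m<d * N. (1 - q ^ m) ^ r m) \<longlonglongrightarrow> L"
  shows "(\<lambda>n. real (card (colored_partitions r n)) * q ^ n) sums (1 / L)"
proof -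
  define w where "w P = (\<Sum>(m, c) \<in># P. m)" for P :: "(nat \<times> nat) multiset"
  define M where "M = {P. \<forall>(m, c) \<in># P. 0 < m \<and> c < r m}"
  define A where "A N = (SIGMA m:{..<N}. {..<r m})" for N
  define G where "G N = (\<Prod>m<N. (1 - q ^ m) ^ r m)" for N
  have pos: "0 < fst x" if "x \<in> A N" for x N
    using that r0 by (cases "fst x") (auto simp: A_def)
  have wq: "(\<Prod>x\<in>#P. q ^ fst x) = q ^ w P" for P :: "(nat \<times> nat) multiset"
    by (simp add: w_def case_prod_unfold prod_mset_power)
  have part: "((\<lambda>P. q ^ w P) has_sum (1 / G N)) {P. set_mset P \<subseteq> A N}" for N
  proof -
    have fin: "finite (A N)"
      by (simp add: A_def)
    have "(\<Prod>x\<in>A N. 1 / (1 - q ^ fst x)) = (\<Prod>m<N. \<Prod>c<r m. 1 / (1 - q ^ m))"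
      unfolding A_def by (subst prod.Sigma) (auto simp: case_prod_unfold)
    also have "\<dots> = 1 / G N"
      by (simp add: G_def prod_dividef power_one_over)
    finally show ?thesis
      using has_sum_prod_mset_geometric[OF fin, of "\<lambda>x. q ^ fst x"] q pos
      by (auto simp: wq power_less_one_iff)
  qed
  have AM: "{P. set_mset P \<subseteq> A N} \<subseteq> M" for N
    using pos by (fastforce simp: M_def A_def)
  have limG: "(\<lambda>N. 1 / G (d * N)) \<longlonglongrightarrow> 1 / L"
    using lim L by (intro tendsto_divide tendsto_const) (auto simp: G_def)
  have fin_le: "(\<Sum>P\<in>F. q ^ w P) \<le> 1 / L" if F: "finite F" "F \<subseteq> M" for F
  proof -
    define B where "B = (\<Union>P\<in>F. fst ` set_mset P)"
    have "finite B"
      using F by (auto simp: B_def)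
    then obtain N where N: "\<And>m. m \<in> B \<Longrightarrow> m < N"
      by (meson finite_nat_set_iff_bounded)
    have "(\<Sum>P\<in>F. q ^ w P) \<le> 1 / G (d * n)" if n: "n \<ge> N" for n
    proof (rule finite_sum_le_has_sum[OF part])
      have *: "m < d * n" if "m \<in> B" for m
      proof -
        have "n \<le> d * n"
          using d by simp
        with N[OF that] n show ?thesis
          by linarith
      qed
      show "F \<subseteq> {P. set_mset P \<subseteq> A (d * n)}"
      proof (intro subsetI CollectI)
        fix P x assume "P \<in> F" "x \<in># P"
        moreover from this have "fst x \<in> B"
          by (auto simp: B_def)
        ultimately show "x \<in> A (d * n)"
          using F(2) * by (cases x) (auto simp: M_def A_def)
      qed
    qed (use F q in auto)
    then show ?thesis
      by (intro LIMSEQ_le_const[OF limG]) auto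
  qed
  have "(\<lambda>P. q ^ w P) summable_on M"
    by (intro nonneg_bdd_above_summable_on bdd_aboveI2[where M = "1 / L"]) (use q fin_le in auto)
  then obtain S where S: "((\<lambda>P. q ^ w P) has_sum S) M"
    by (auto simp: summable_on_def)
  have "S \<le> 1 / L"
    using S fin_le by (rule has_sum_le_finite_sums)
  moreover have "1 / L \<le> S"
    using q by (intro LIMSEQ_le_const2[OF limG] exI[of _ 0] allI impI has_sum_mono2[OF part S AM]) auto
  ultimately have SL: "S = 1 / L"
    by simp
  \<comment> \<open>Regrouping by size: the members \<open>P\<close> of \<open>M\<close> with
    \<open>w P = n\<close> are exactly \<open>colored_partitions r n\<close>.\<close>
  have "((\<lambda>P. q ^ w P) has_sum S) M \<longleftrightarrow>
      ((\<lambda>(n, P). q ^ n) has_sum S) (Sigma UNIV (colored_partitions r))"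
    by (rule has_sum_reindex_bij_witness[where j = "\<lambda>P. (w P, P)" and i = snd])
      (auto simp: M_def w_def colored_partitions_def)
  with S have "((\<lambda>(n, P). q ^ n) has_sum S) (Sigma UNIV (colored_partitions r))"
    by simp
  then have "((\<lambda>n. real (card (colored_partitions r n)) * q ^ n) has_sum S) UNIV"
    by (rule has_sum_SigmaD) (simp add: has_sum_finite_iff finite_colored_partitions)
  then show ?thesis
    unfolding SL by (rule has_sum_imp_sums)
qed

section \<open>Uniqueness of power series coefficients\<close>

text \<open>Once the coefficients before \<open>a n\<close> vanish, dividing by \<open>x ^ n\<close>
  leaves a series that is zero on (0, 1) and tends to \<open>a n\<close> as \<open>x\<close> tends
  to 0 from the right.\<close>

lemma powser_eq_0_at_right_imp_coeff_eq_0: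
  fixes a :: "nat \<Rightarrow> real"
  assumes sums: "\<And>x. 0 < x \<Longrightarrow> x < 1 \<Longrightarrow> (\<lambda>n. a n * x ^ n) sums 0"
  shows "a n = 0"
proof (induction n rule: less_induct)
  case (less n)
  define f where "f x = (\<Sum>k. a (k + n) * x ^ k)" for x
  have eq0: "(\<lambda>k. a (k + n) * x ^ k) sums 0" if x: "0 < x" "x < 1" for x
  proof -
    have "(\<lambda>k. a (k + n) * x ^ (k + n)) sums 0"
      using sums_split_initial_segment[OF sums[OF x], of n] less by simp
    from sums_mult[OF this, of "1 / x ^ n"] x show ?thesis
      by (simp add: power_add)
  qed
  have "(\<lambda>k. a (k + n) * x ^ k) sums f x" if x: "norm x < 1" for x
  proof -
    \<comment> \<open>The hypothesis covers positive arguments only; convergence at such a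
      \<open>y\<close> gives it at \<open>x\<close> of either sign.\<close>
    obtain y where y: "norm x < y" "y < 1"
      using dense[OF x] by blast
    then have "0 < y"
      by (smt (verit) norm_ge_zero)
    then show ?thesis
      unfolding f_def using y
      by (intro summable_sums powser_inside[OF sums_summable[OF eq0[of y]]]) auto
  qed
  then have "(f \<longlongrightarrow> a (0 + n)) (at 0)"
    by (intro powser_limit_0_strong[where s = 1]) auto
  then have "(f \<longlongrightarrow> a n) (at_right 0)"
    by (simp add: filterlim_at_split)
  moreover have "\<forall>\<^sub>F x in at_right 0. f x = 0"
    using eq0 by (auto simp: eventually_at_right_field f_def sums_iff intro!: exI[of _ 1])
  then have "(f \<longlongrightarrow> 0) (at_right 0)"
    by (rule tendsto_eventually)
  ultimately show ?case
    using tendsto_unique trivial_limit_at_right_real by blast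
qed

subsection \<open>The Jacobi triple product\<close>

text \<open>The Gaussian binomial coefficient, given by its Pascal rule so that no division
  occurs.\<close>

fun qbinomial :: "'a :: comm_semiring_1 \<Rightarrow> nat \<Rightarrow> nat \<Rightarrow> 'a" where
  "qbinomial p n 0 = 1"
| "qbinomial p 0 (Suc k) = 0"
| "qbinomial p (Suc n) (Suc k) = qbinomial p n k + p ^ Suc k * qbinomial p n (Suc k)"

lemma qbinomial_eq_0: "n < k \<Longrightarrow> qbinomial p n k = 0"
proof (induction n arbitrary: k)
  case 0
  then show ?case by (cases k) auto
next
  case (Suc n)
  then show ?case by (cases k) auto
qed

lemma qbinomial_self [simp]: "qbinomial p n n = 1"
  by (induction n) (simp_all add: qbinomial_eq_0)

text \<open>Splitting off the factor \<open>1 + x\<close> leaves the product of \<open>n\<close>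
  factors at \<open>x * p\<close>; comparing coefficients of \<open>x ^ Suc i\<close> is then the
  Pascal rule.\<close>

lemma q_binomial_theorem:
  fixes x p :: "'a :: comm_semiring_1"
  shows "(\<Prod>k<n. 1 + x * p ^ k) = (\<Sum>i\<le>n. qbinomial p n i * p ^ (i choose 2) * x ^ i)"
proof (induction n arbitrary: x)
  case (Suc n)
  define t where "t i = qbinomial p n i * p ^ (i choose 2) * (x * p) ^ i" for i
  have choose: "Suc i choose 2 = i + (i choose 2)" for i
    by (simp add: numeral_2_eq_2)
  have "(\<Prod>k<Suc n. 1 + x * p ^ k) = (1 + x) * (\<Prod>k<n. 1 + (x * p) * p ^ k)"
    by (simp only: prod.lessThan_Suc_shift) (simp add: mult_ac)
  also have "\<dots> = (1 + x) * (\<Sum>i\<le>n. t i)"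
    by (simp only: Suc.IH t_def)
  \<comment> \<open>The added top term \<open>t (Suc n)\<close> is zero.\<close>
  also have "\<dots> = (\<Sum>i\<le>Suc n. t i) + (\<Sum>i\<le>n. x * t i)"
    by (simp add: ring_distribs sum_distrib_left t_def qbinomial_eq_0 sum.distrib)
  also have "\<dots> = 1 + (\<Sum>i\<le>n. t (Suc i) + x * t i)"
    by (subst sum.atMost_Suc_shift) (simp add: sum.distrib t_def add_ac numeral_2_eq_2)
  also have "(\<Sum>i\<le>n. t (Suc i) + x * t i) =
      (\<Sum>i\<le>n. qbinomial p (Suc n) (Suc i) * p ^ (Suc i choose 2) * x ^ Suc i)"
    by (intro sum.cong refl) (simp add: t_def choose power_add power_mult_distrib algebra_simps)
  also have "1 + (\<Sum>i\<le>n. qbinomial p (Suc n) (Suc i) * p ^ (Suc i choose 2) * x ^ Suc i) =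
      (\<Sum>i\<le>Suc n. qbinomial p (Suc n) i * p ^ (i choose 2) * x ^ i)"
    by (subst sum.atMost_Suc_shift) (simp add: numeral_2_eq_2)
  finally show ?case .
qed (simp add: numeral_2_eq_2)

text \<open>The finite Pochhammer symbol (p; p)_n.\<close>

definition qpoch :: "'a :: comm_ring_1 \<Rightarrow> nat \<Rightarrow> 'a" where
  "qpoch p n = (\<Prod>k<n. 1 - p ^ Suc k)"

lemma qpoch_0 [simp]: "qpoch p 0 = 1"
  and qpoch_Suc: "qpoch p (Suc n) = qpoch p n * (1 - p ^ Suc n)"
  by (simp_all add: qpoch_def)

text \<open>The Pascal rule reduces this to \<open>(1 - p ^ Suc l) + p ^ Suc l * (1 - p ^ Suc m) = 1
  - p ^ Suc l * p ^ Suc m\<close>.\<close>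

lemma qbinomial_mult_qpoch:
  "k \<le> n \<Longrightarrow> qbinomial p n k * (qpoch p k * qpoch p (n - k)) = qpoch p n"
proof (induction n arbitrary: k)
  case (Suc n)
  show ?case
  proof (cases k)
    case (Suc l)
    show ?thesis
    proof (cases "l = n")
      case True
      then show ?thesis
        by (simp add: Suc)
    next
      case False
      then have "l < n"
        using Suc Suc.prems by simp
      then obtain m where m: "n = Suc (l + m)"
        using less_natE by auto
      have IH1: "qbinomial p n l * (qpoch p l * qpoch p (Suc m)) = qpoch p n"
        using Suc.IH[of l] by (simp add: m)
      have IH2: "qbinomial p n (Suc l) * (qpoch p (Suc l) * qpoch p m) = qpoch p n"
        using Suc.IH[of "Suc l"] by (simp add: m)
      have "qbinomial p (Suc n) k * (qpoch p k * qpoch p (Suc n - k)) =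
          (qbinomial p n l * (qpoch p l * qpoch p (Suc m))) * (1 - p ^ Suc l) +
          p ^ Suc l * (1 - p ^ Suc m) * (qbinomial p n (Suc l) * (qpoch p (Suc l) * qpoch p m))"
        by (simp add: Suc m qpoch_Suc[of p l] qpoch_Suc[of p m] algebra_simps)
      also have "\<dots> = qpoch p n * (1 - p ^ Suc l * p ^ Suc m)"
        unfolding IH1 IH2 by (simp add: algebra_simps)
      also have "\<dots> = qpoch p (Suc n)"
        by (simp add: qpoch_Suc m power_add algebra_simps)
      finally show ?thesis .
    qed
  qed simp
qed simp

text \<open>A partial product of (z, p / z; p)_infinity.\<close>

definition theta_trunc :: "real \<Rightarrow> real \<Rightarrow> nat \<Rightarrow> real" where
  "theta_trunc p z N = (\<Prod>k<N. (1 - z * p ^ k) * (1 - p ^ Suc k / z))"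

text \<open>The exponent of \<open>p\<close> is an integer, but a real power lets it be split into
  quarters of squares in \<open>theta_mult_theta\<close>.\<close>

definition theta_term :: "real \<Rightarrow> real \<Rightarrow> int \<Rightarrow> real" where
  "theta_term p z j = p powr (of_int j * (of_int j - 1) / 2) * (- z) powi j"

text \<open>The \<open>q\<close>-binomial theorem with \<open>n = 2 N\<close> and \<open>x = - z / p\<^sup>N\<close>, after pulling \<open>- z / p\<^sup>k\<close> out of half of the factors.\<close>
lemma finite_triple_product:
  assumes p: "0 < p" and z: "z \<noteq> 0"
  shows "theta_trunc p z N =
    (\<Sum>j\<in>{- int N..int N}. qbinomial p (2 * N) (nat (int N + j)) * theta_term p z j)"
proof -
  have split: "(\<Prod>k<N + M. f k) = (\<Prod>k<N. f k) * (\<Prod>k<M. f (N + k))" for f :: "nat \<Rightarrow> real" and M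
    by (induction M) (simp_all add: mult_ac)
  have shift: "1 + (- z / p ^ N) * p ^ (N - Suc k) = (- z / p ^ Suc k) * (1 - p ^ Suc k / z)"
    if k: "k < N" for k
  proof -
    have "p ^ N = p ^ (N - Suc k) * p ^ Suc k"
      using k by (simp only: power_add[symmetric]) simp
    then show ?thesis
      using p z by (simp add: field_simps)
  qed
  have front: "(\<Prod>k<M. - z / p ^ Suc k) = (- z) ^ M * p powr (- (real M * (real M + 1) / 2))" for M
  proof (induction M)
    case (Suc M)
    have powr_Suc: "p powr (- real (Suc M)) = 1 / p ^ Suc M"
      using p by (simp add: powr_minus powr_realpow inverse_eq_divide del: of_nat_Suc power_Suc)
    have "(\<Prod>k<Suc M. - z / p ^ Suc k) =
        (- z) ^ Suc M * (p powr (- (real M * (real M + 1) / 2)) * p powr (- real (Suc M)))"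
      unfolding prod.lessThan_Suc Suc.IH powr_Suc by (simp del: of_nat_Suc)
    also have "p powr (- (real M * (real M + 1) / 2)) * p powr (- real (Suc M)) =
        p powr (- (real (Suc M) * (real (Suc M) + 1) / 2))"
      unfolding powr_add[symmetric]
      by (rule arg_cong[of _ _ "(powr) p"]) (simp add: field_simps)
    finally show ?case .
  qed (use p in simp)
  have choose: "real (n choose 2) = real n * (real n - 1) / 2" for n
    by (induction n) (simp_all add: numeral_2_eq_2 field_simps)
  define c where "c = (- z) ^ N * p powr (- (real N * (real N + 1) / 2))"
  have c0: "c \<noteq> 0"
    using p z by (simp add: c_def)
  have "(\<Prod>k<N + N. 1 + (- z / p ^ N) * p ^ k) =
      (\<Prod>k<N. 1 + (- z / p ^ N) * p ^ k) * (\<Prod>k<N. 1 + (- z / p ^ N) * p ^ (N + k))"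
    by (rule split)
  \<comment> \<open>Reversal turns the \<open>k\<close>-th factor into
    \<open>1 - z / p ^ Suc k\<close>, from which \<open>- z / p ^ Suc k\<close> is pulled
    out.\<close>
  also have "(\<Prod>k<N. 1 + (- z / p ^ N) * p ^ k) = (\<Prod>k<N. 1 + (- z / p ^ N) * p ^ (N - Suc k))"
    by (rule prod.nat_diff_reindex[symmetric])
  also have "\<dots> = (\<Prod>k<N. - z / p ^ Suc k) * (\<Prod>k<N. 1 - p ^ Suc k / z)"
    unfolding prod.distrib[symmetric] by (intro prod.cong refl shift) simp
  also have "(\<Prod>k<N. - z / p ^ Suc k) = c"
    unfolding c_def by (rule front)
  also have "(\<Prod>k<N. 1 + (- z / p ^ N) * p ^ (N + k)) = (\<Prod>k<N. 1 - z * p ^ k)"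
    using p by (simp add: power_add)
  finally have prod: "(\<Prod>k<2 * N. 1 + (- z / p ^ N) * p ^ k) = c * theta_trunc p z N"
    unfolding mult_2 theta_trunc_def prod.distrib by (simp only: mult_ac)
  \<comment> \<open>With \<open>j = i - N\<close> one has
    \<open>i * (i - 1) / 2 - N * i = j * (j - 1) / 2 - N * (N + 1) / 2\<close>, so the same
    \<open>c\<close> comes out of every term.\<close>
  have term_eq: "p ^ (i choose 2) * (- z / p ^ N) ^ i = c * theta_term p z (int i - int N)" for i
  proof -
    have z': "(- z) powi (int i - int N) = (- z) ^ i / (- z) ^ N"
      using z by (simp add: power_int_diff)
    have pn: "p powr (- real (N * i)) = 1 / (p ^ N) ^ i"
      using p by (simp add: powr_minus powr_realpow power_mult inverse_eq_divide del: of_nat_mult)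
    have "p ^ (i choose 2) * (- z / p ^ N) ^ i =
        (- z) ^ i * (p powr real (i choose 2) * p powr (- real (N * i)))"
      unfolding pn powr_realpow[OF p] power_divide by simp
    also have "p powr real (i choose 2) * p powr (- real (N * i)) =
        p powr (- (real N * (real N + 1) / 2)) *
        p powr (of_int (int i - int N) * (of_int (int i - int N) - 1) / 2)"
      unfolding powr_add[symmetric]
      by (rule arg_cong[of _ _ "(powr) p"]) (simp add: choose field_simps)
    finally show ?thesis
      using z by (simp add: c_def theta_term_def z')
  qed
  have "c * theta_trunc p z N = (\<Sum>i\<le>2 * N. qbinomial p (2 * N) i * (p ^ (i choose 2) * (- z / p ^ N) ^ i))"
    unfolding prod[symmetric] q_binomial_theorem by (simp add: mult_ac)
  also have "\<dots> = c * (\<Sum>i\<le>2 * N. qbinomial p (2 * N) i * theta_term p z (int i - int N))"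
    by (simp only: term_eq sum_distrib_left mult.left_commute)
  also have "(\<Sum>i\<le>2 * N. qbinomial p (2 * N) i * theta_term p z (int i - int N)) =
      (\<Sum>j\<in>{- int N..int N}. qbinomial p (2 * N) (nat (int N + j)) * theta_term p z j)"
    by (rule sum.reindex_bij_witness[where i = "\<lambda>j. nat (int N + j)" and j = "\<lambda>i. int i - int N"]) auto
  finally show ?thesis
    using c0 by simp
qed

section \<open>Convergence of the products and of the theta series\<close>

text \<open>No factor vanishes, so the convergent product has a nonzero limit; its positivity
  permits dividing by it later.\<close>

lemma tendsto_prod_one_minus:
  fixes a :: "nat \<Rightarrow> real"
  assumes a: "\<And>k. 0 \<le> a k" "\<And>k. a k < 1" and sum: "summable a"
  obtains L where "0 < L" "(\<lambda>n. \<Prod>k<n. 1 - a k) \<longlonglongrightarrow> L"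
proof -
  have conv: "convergent_prod (\<lambda>k. 1 + - a k)"
    using a sum by (intro summable_imp_convergent_prod_real) (auto simp: less_le)
  then have lim: "(\<lambda>n. \<Prod>k<n. 1 - a k) \<longlonglongrightarrow> prodinf (\<lambda>k. 1 - a k)"
    using convergent_prod_LIMSEQ[OF conv] by (simp add: LIMSEQ_lessThan_iff_atMost)
  have "prodinf (\<lambda>k. 1 - a k) \<noteq> 0"
    using conv a(2) by (intro prodinf_nonzero) (auto simp: less_le)
  moreover have "0 \<le> prodinf (\<lambda>k. 1 - a k)"
    using a by (intro LIMSEQ_le_const[OF lim] exI[of _ 0] allI impI prod_nonneg) (auto simp: less_imp_le)
  ultimately show thesis
    by (intro that[OF _ lim]) simp
qed

text \<open>Completing the square bounds the exponent by \<open>K - \<bar>x\<bar>\<close>, so a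
  two-sided geometric series dominates.\<close>

lemma summable_on_exp_quadratic:
  fixes b c :: real
  assumes c: "0 < c"
  shows "(\<lambda>j::int. exp (b * of_int j - c * (of_int j)\<^sup>2)) summable_on A"
proof -
  \<comment> \<open>The maximum of \<open>(\<bar>b\<bar> + 1) * t - c * t\<^sup>2\<close> over real
    \<open>t\<close>.\<close>
  define K where "K = (\<bar>b\<bar> + 1)\<^sup>2 / (4 * c)"
  have le: "b * x - c * x\<^sup>2 \<le> K - \<bar>x\<bar>" for x
  proof -
    have "0 \<le> (2 * c * \<bar>x\<bar> - (\<bar>b\<bar> + 1))\<^sup>2 / (4 * c)"
      using c by simp
    also have "\<dots> = c * \<bar>x\<bar>\<^sup>2 - (\<bar>b\<bar> + 1) * \<bar>x\<bar> + K"
      using c by (simp add: K_def power2_eq_square field_simps)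
    finally have "(\<bar>b\<bar> + 1) * \<bar>x\<bar> - c * x\<^sup>2 \<le> K"
      by simp
    moreover have "b * x \<le> \<bar>b\<bar> * \<bar>x\<bar>"
      by (metis abs_ge_self abs_mult)
    ultimately show ?thesis
      by (simp add: algebra_simps)
  qed
  have "summable (\<lambda>n. exp (-1 :: real) ^ n)"
    by (intro summable_geometric) simp
  then have "summable (\<lambda>n. exp K * exp (-1) ^ n)"
    by (rule summable_mult)
  moreover have "exp K * exp (-1) ^ n = exp (K - real n)" for n
    by (simp add: exp_of_nat_mult[symmetric] exp_add[symmetric])
  ultimately have geo: "(\<lambda>n. exp (K - real n)) summable_on UNIV"
    by (intro norm_summable_imp_summable_on) simp
  have "(\<lambda>j::int. exp (K - \<bar>of_int j\<bar>)) summable_on {0..}"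
    using geo by (subst summable_on_reindex_bij_witness[where i = int and j = nat and T = UNIV
        and h = "\<lambda>n. exp (K - real n)"]) auto
  moreover have "(\<lambda>j::int. exp (K - \<bar>of_int j\<bar>)) summable_on {..0}"
    using geo by (subst summable_on_reindex_bij_witness[where i = "\<lambda>n. - int n" and j = "\<lambda>j. nat (- j)"
        and T = UNIV and h = "\<lambda>n. exp (K - real n)"]) auto
  ultimately have "(\<lambda>j::int. exp (K - \<bar>of_int j\<bar>)) summable_on {0..} \<union> {..0}"
    by (rule summable_on_union)
  then have "(\<lambda>j::int. exp (K - \<bar>of_int j\<bar>)) summable_on A"
    by (rule summable_on_subset) auto
  then show ?thesis
    by (rule summable_on_comparison_test) (use le in auto)
qed

text \<open>Since \<open>ln p < 0\<close>, this is the exponential form above. It serves both the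
  theta terms (\<open>a = 1 / 2\<close>) and the half series (\<open>a = 1 / 4\<close>).\<close>

lemma summable_on_powr_quadratic:
  fixes p x a b :: real
  assumes "0 < p" "p < 1" "0 < x" "0 < a"
  shows "(\<lambda>j::int. p powr (a * (of_int j)\<^sup>2 + b * of_int j) * x powi j) summable_on A"
proof -
  have "p powr (a * (of_int j)\<^sup>2 + b * of_int j) * x powi j =
      exp ((b * ln p + ln x) * of_int j - (- a * ln p) * (of_int j)\<^sup>2)" for j
    using assms by (simp add: powr_def powr_real_of_int'[symmetric] algebra_simps flip: exp_add)
  moreover have "0 < - a * ln p"
    using assms by (simp add: mult_neg_pos mult_less_0_iff)
  ultimately show ?thesis
    using summable_on_exp_quadratic by presburger
qed

lemma abs_theta_term:
  assumes "0 < z"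
  shows "\<bar>theta_term p z j\<bar> = p powr (1 / 2 * (of_int j)\<^sup>2 + (- 1 / 2) * of_int j) * z powi j"
proof -
  have "\<bar>(- z) powi j\<bar> = z powi j"
    using assms by (simp add: power_int_abs)
  moreover have "of_int j * (of_int j - 1) / 2 = 1 / 2 * (of_int j)\<^sup>2 + (- 1 / 2) * (of_int j :: real)"
    by (simp add: power2_eq_square field_simps)
  ultimately show ?thesis
    by (simp only: theta_term_def abs_mult abs_of_nonneg[OF powr_ge_zero])
qed

lemma theta_term_abs_summable:
  assumes "0 < p" "p < 1" "0 < z"
  shows "(\<lambda>j. \<bar>theta_term p z j\<bar>) summable_on A"
  unfolding abs_theta_term[OF assms(3)] by (rule summable_on_powr_quadratic) (use assms in auto)


section \<open>Passage to the limit in the finite triple product\<close>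

definition theta :: "real \<Rightarrow> real \<Rightarrow> real" where
  "theta p z = (\<Sum>\<^sub>\<infinity>j. theta_term p z j)"

lemma qpoch_tendsto:
  fixes p :: real
  assumes "0 < p" "p < 1"
  obtains L where "0 < L" "qpoch p \<longlonglongrightarrow> L"
proof -
  have sm: "summable (\<lambda>k. p ^ Suc k)"
    using assms by (simp add: summable_geometric summable_mult)
  have "0 \<le> p ^ Suc k" "p ^ Suc k < 1" for k
    using assms power_strict_decreasing[of 0 "Suc k" p] by simp_all
  from tendsto_prod_one_minus[OF this sm] show thesis
    using that unfolding qpoch_def[abs_def] by blast
qed

text \<open>The partial products decrease from 1 to their limit.\<close>

lemma qpoch_bounds:
  fixes p :: real
  assumes p: "0 < p" "p < 1" and L: "qpoch p \<longlonglongrightarrow> L"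
  shows "L \<le> qpoch p n" "qpoch p n \<le> 1"
proof -
  have lt: "p ^ Suc n < 1" for n
    using p power_strict_decreasing[of 0 "Suc n" p] by simp
  have pos: "0 \<le> qpoch p n" for n
    unfolding qpoch_def using lt by (intro prod_nonneg) (auto simp: less_imp_le simp del: power_Suc)
  have "qpoch p (Suc n) \<le> qpoch p n" for n
    unfolding qpoch_Suc using pos p by (intro mult_left_le) auto
  then have dec: "decseq (qpoch p)"
    by (rule decseq_SucI)
  show "L \<le> qpoch p n"
    using dec L by (rule decseq_ge)
  show "qpoch p n \<le> 1"
    using decseqD[OF dec, of 0 n] by simp
qed

text \<open>In the quotient formula the numerator is at most 1 and the denominator at least
  \<open>L\<^sup>2\<close>. The bound is uniform in \<open>n\<close> and \<open>k\<close>, as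
  dominated convergence requires.\<close>

lemma qbinomial_bounds:
  fixes p :: real
  assumes p: "0 < p" "p < 1" and L: "0 < L" "qpoch p \<longlonglongrightarrow> L"
  shows "\<bar>qbinomial p n k\<bar> \<le> 1 / L\<^sup>2"
proof (cases "k \<le> n")
  case True
  note bounds = qpoch_bounds[OF p L(2)]
  have le: "L\<^sup>2 \<le> qpoch p k * qpoch p (n - k)"
    unfolding power2_eq_square using L bounds by (intro mult_mono) (auto intro: less_le_trans less_imp_le)
  then have pos: "0 < qpoch p k * qpoch p (n - k)"
    using L by (smt (verit) zero_less_power)
  then have "qbinomial p n k = qpoch p n / (qpoch p k * qpoch p (n - k))"
    using qbinomial_mult_qpoch[OF True, of p] by (metis less_irrefl nonzero_eq_divide_eq)
  moreover have "0 \<le> qpoch p n"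
    using bounds(1)[of n] L by linarith
  ultimately have "\<bar>qbinomial p n k\<bar> = qpoch p n / (qpoch p k * qpoch p (n - k))"
    using pos by simp
  also have "\<dots> \<le> 1 / L\<^sup>2"
    using bounds(2) le L by (intro frac_le) auto
  finally show ?thesis .
qed (simp add: qbinomial_eq_0)

text \<open>For fixed \<open>j\<close> the indices \<open>2 * N\<close>, \<open>N + j\<close> and
  \<open>N - j\<close> all tend to infinity, so the quotient formula tends to
  \<open>L / (L * L)\<close>.\<close>

lemma central_qbinomial_tendsto:
  fixes p :: real and j :: int
  assumes L: "0 < L" "qpoch p \<longlonglongrightarrow> L"
  shows "(\<lambda>N. qbinomial p (2 * N) (nat (int N + j))) \<longlonglongrightarrow> 1 / L"
proof -
  have at_top: "filterlim (\<lambda>N. nat (int N + i)) at_top at_top" for i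
    unfolding filterlim_at_top
  proof
    fix M
    show "\<forall>\<^sub>F N in sequentially. M \<le> nat (int N + i)"
      by (rule eventually_sequentiallyI[of "M + nat \<bar>i\<bar>"]) arith
  qed
  have lim2: "(\<lambda>N. qpoch p (2 * N)) \<longlonglongrightarrow> L"
    by (rule LIMSEQ_subseq_LIMSEQ[OF L(2), unfolded comp_def]) (simp add: strict_mono_def)
  have lim1: "(\<lambda>N. qpoch p (nat (int N + i))) \<longlonglongrightarrow> L" for i
    using L(2) at_top by (rule filterlim_compose)
  have lim: "(\<lambda>N. qpoch p (2 * N) / (qpoch p (nat (int N + j)) * qpoch p (nat (int N + - j))))
      \<longlonglongrightarrow> L / (L * L)"
    by (intro tendsto_divide tendsto_mult lim1 lim2) (use L in simp)
  have pos: "\<forall>\<^sub>F N in sequentially. 0 < qpoch p (nat (int N + i))" for i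
    using order_tendstoD(1)[OF L(2,1)] at_top by (rule eventually_compose_filterlim)
  have "\<forall>\<^sub>F N in sequentially.
      qpoch p (2 * N) / (qpoch p (nat (int N + j)) * qpoch p (nat (int N + - j))) =
      qbinomial p (2 * N) (nat (int N + j))"
    using pos[of j] pos[of "- j"] eventually_ge_at_top[of "nat \<bar>j\<bar>"]
  proof eventually_elim
    case (elim N)
    then have "nat (int N + j) \<le> 2 * N" "2 * N - nat (int N + j) = nat (int N + - j)"
      by auto
    with qbinomial_mult_qpoch[of "nat (int N + j)" "2 * N" p] elim show ?case
      by (simp add: divide_eq_eq)
  qed
  from Lim_transform_eventually[OF lim this] L show ?thesis
    by simp
qed

text \<open>Tannery's theorem applied to \<open>finite_triple_product\<close>: each coefficient
  tends to \<open>1 / L\<close>, and the terms are dominated by a multiple of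
  \<open>\<bar>theta_term p z j\<bar>\<close>.\<close>

theorem jacobi_triple_product:
  assumes p: "0 < p" "p < 1" and L: "0 < L" "qpoch p \<longlonglongrightarrow> L" and z: "0 < z"
  shows "theta_trunc p z \<longlonglongrightarrow> theta p z / L"
proof -
  \<comment> \<open>Coefficients extended by 0 make the index set independent of
    \<open>N\<close>.\<close>
  define c where "c N j = (if j \<in> {- int N..int N} then qbinomial p (2 * N) (nat (int N + j)) else 0)"
    for N j
  \<comment> \<open>Enumerating the integers turns unordered sums into ordinary series.\<close>
  have int_decode: "((\<lambda>j. f j) has_sum s) UNIV \<longleftrightarrow> ((\<lambda>k. f (int_decode k)) has_sum s) UNIV"
    for f :: "int \<Rightarrow> real" and s
    by (rule has_sum_reindex_bij_witness[where j = int_encode and i = int_decode]) auto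
  have trunc: "theta_trunc p z N = (\<Sum>k. c N (int_decode k) * theta_term p z (int_decode k))" for N
  proof -
    have "theta_trunc p z N = (\<Sum>j\<in>{- int N..int N}. c N j * theta_term p z j)"
      using finite_triple_product[of p z N] p z by (simp add: c_def)
    then have "((\<lambda>j. c N j * theta_term p z j) has_sum theta_trunc p z N) UNIV"
      by (intro has_sum_finite_neutralI[where B = "{- int N..int N}"]) (auto simp: c_def)
    then show ?thesis
      by (simp add: int_decode has_sum_imp_sums sums_unique)
  qed
  have abs_sum: "(\<lambda>j. \<bar>theta_term p z j\<bar>) summable_on UNIV"
    by (rule theta_term_abs_summable[OF p z])
  have sum: "((\<lambda>j. theta_term p z j) has_sum theta p z) UNIV"
    unfolding theta_def by (rule has_sum_infsum, rule abs_summable_summable) (use abs_sum in simp)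
  have "(\<lambda>N. \<Sum>k. c N (int_decode k) * theta_term p z (int_decode k))
      \<longlonglongrightarrow> (\<Sum>k. (1 / L) * theta_term p z (int_decode k))"
  proof (rule conjunct2[OF conjunct2[OF tannerys_theorem]])
    show "(\<lambda>N. c N (int_decode k) * theta_term p z (int_decode k))
        \<longlonglongrightarrow> (1 / L) * theta_term p z (int_decode k)" for k
    proof (intro tendsto_mult tendsto_const)
      have "\<forall>\<^sub>F N in sequentially.
          qbinomial p (2 * N) (nat (int N + int_decode k)) = c N (int_decode k)"
        by (rule eventually_sequentiallyI[of "nat \<bar>int_decode k\<bar>"]) (auto simp: c_def)
      with central_qbinomial_tendsto[OF L] show "(\<lambda>N. c N (int_decode k)) \<longlonglongrightarrow> 1 / L"
        by (rule Lim_transform_eventually)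
    qed
    have "\<bar>c N j\<bar> \<le> 1 / L\<^sup>2" for N j
      using qbinomial_bounds[OF p L] by (simp add: c_def)
    then show "\<forall>\<^sub>F (k, N) in at_top \<times>\<^sub>F sequentially.
        norm (c N (int_decode k) * theta_term p z (int_decode k)) \<le>
        1 / L\<^sup>2 * \<bar>theta_term p z (int_decode k)\<bar>"
      by (intro always_eventually) (auto simp: abs_mult simp del: times_divide_eq_left intro!: mult_right_mono)
    obtain s where "((\<lambda>j. \<bar>theta_term p z j\<bar>) has_sum s) UNIV"
      using abs_sum by (auto simp: summable_on_def)
    then show "summable (\<lambda>k. 1 / L\<^sup>2 * \<bar>theta_term p z (int_decode k)\<bar>)"
      by (intro summable_mult) (auto simp: int_decode dest: has_sum_imp_sums sums_summable)
  qed simp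
  also have "(\<lambda>N. \<Sum>k. c N (int_decode k) * theta_term p z (int_decode k)) = theta_trunc p z"
    using trunc by auto
  also have "(\<Sum>k. (1 / L) * theta_term p z (int_decode k)) = theta p z / L"
    using sums_mult[OF has_sum_imp_sums[OF sum[unfolded int_decode]], of "1 / L"]
    by (simp add: sums_iff)
  finally show ?thesis .
qed


subsection \<open>The three-term relation\<close>

text \<open>For \<open>A\<close> the odd and the even integers these are the two coordinates of the
  vector attached to \<open>x\<close>.\<close>

definition theta_half :: "real \<Rightarrow> int set \<Rightarrow> real \<Rightarrow> real" where
  "theta_half p A x = (\<Sum>\<^sub>\<infinity>t\<in>A. p powr ((of_int t)\<^sup>2 / 4) * x powi t)"

lemma has_sum_theta_half:
  assumes "0 < p" "p < 1" "0 < x"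
  shows "((\<lambda>t. p powr ((of_int t)\<^sup>2 / 4) * x powi t) has_sum theta_half p A x) A"
  unfolding theta_half_def
  using summable_on_powr_quadratic[OF assms, of "1 / 4" 0 A] by (intro has_sum_infsum) simp

text \<open>With \<open>s = m + n\<close> and \<open>t = m - n\<close> the double series runs over
  pairs of equal parity with sign \<open>(- 1) powi s\<close>; the even and the odd pairs give the
  two products of the determinant.\<close>

lemma theta_mult_theta:
  assumes p: "0 < p" "p < 1" and x: "0 < x" and y: "0 < y"
  shows "theta p (x * y) * theta p (x / y) = p powr (- 1 / 4) * x *
    (theta_half p {t. odd t} x * theta_half p {t. even t} y -
     theta_half p {t. even t} x * theta_half p {t. odd t} y)"
proof -
  define c where "c = p powr (- 1 / 4) * x"
  define b where "b z t = p powr ((of_int t)\<^sup>2 / 4) * z powi t" for z :: real and t :: int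
  define h where "h s t = c * b x (s - 1) * b y t" for s t
  define sgn where "sgn = (\<lambda>(s, t). if even s then h s t else - h s t)"
  have hb: "(b z has_sum theta_half p A z) A" if "0 < z" for z A
    unfolding b_def using has_sum_theta_half[OF p that] .
  have theta: "((\<lambda>j. theta_term p z j) has_sum theta p z) UNIV" if "0 < z" for z
    unfolding theta_def by (rule has_sum_infsum, rule abs_summable_summable)
      (use theta_term_abs_summable[OF p that] in simp)
  have half: "((\<lambda>(s, t). h s t) has_sum c * (theta_half p A x * theta_half p B y))
      ({s. s - 1 \<in> A} \<times> B)" for A B
  proof -
    have "((\<lambda>(s, t). c * (b x s * b y t)) has_sum c * (theta_half p A x * theta_half p B y)) (A \<times> B)"
      using has_sum_cmult_right[OF has_sum_Times_mult[OF hb[OF x] hb[OF y]], of c]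
      by (simp add: case_prod_unfold)
    then show ?thesis
      by (subst has_sum_reindex_bij_witness[where j = "\<lambda>(s, t). (s - 1, t)" and
            i = "\<lambda>(s, t). (s + 1, t)" and T = "A \<times> B" and h = "\<lambda>(s, t). c * (b x s * b y t)"])
        (auto simp: h_def)
  qed
  have term_eq: "theta_term p (x * y) m * theta_term p (x / y) n = sgn (m + n, m - n)" for m n
  proof -
    have "(- (x * y)) powi m = (- 1) powi m * x powi m * y powi m"
      by (simp flip: power_int_mult_distrib)
    moreover have "(- (x / y)) powi n = (- 1) powi n * x powi n / y powi n"
      by (simp flip: power_int_mult_distrib power_int_divide_distrib)
    ultimately have "(- (x * y)) powi m * (- (x / y)) powi n =
        (- 1) powi (m + n) * x powi (m + n) * y powi (m - n)"
      using x y by (simp add: power_int_add power_int_diff)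
    also have "x powi (m + n) = x * x powi (m + n - 1)"
      using x by (simp add: power_int_diff)
    finally have powi: "(- (x * y)) powi m * (- (x / y)) powi n =
        (- 1) powi (m + n) * (x * x powi (m + n - 1)) * y powi (m - n)" .
    \<comment> \<open>Completing the square in \<open>s = m + n\<close>: the exponents add up to
      \<open>(s - 1)\<^sup>2 / 4 + t\<^sup>2 / 4 - 1 / 4\<close>.\<close>
    have powr: "p powr (of_int m * (of_int m - 1) / 2) * p powr (of_int n * (of_int n - 1) / 2) =
        p powr (- 1 / 4) * (p powr ((of_int (m + n - 1))\<^sup>2 / 4) * p powr ((of_int (m - n))\<^sup>2 / 4))"
      unfolding powr_add[symmetric]
      by (rule arg_cong[of _ _ "(powr) p"]) (simp add: power2_eq_square field_simps)
    have "theta_term p (x * y) m * theta_term p (x / y) n =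
        (p powr (of_int m * (of_int m - 1) / 2) * p powr (of_int n * (of_int n - 1) / 2)) *
        ((- (x * y)) powi m * (- (x / y)) powi n)"
      by (simp only: theta_term_def mult_ac)
    also have "\<dots> = (- 1) powi (m + n) * h (m + n) (m - n)"
      unfolding powi powr by (simp only: h_def b_def c_def mult_ac)
    finally show ?thesis
      by (auto simp: sgn_def power_int_minus_left)
  qed
  have "((\<lambda>(m, n). theta_term p (x * y) m * theta_term p (x / y) n) has_sum
      theta p (x * y) * theta p (x / y)) (UNIV \<times> UNIV)"
    using x y by (intro has_sum_Times_mult theta) auto
  also have "?this \<longleftrightarrow> (sgn has_sum theta p (x * y) * theta p (x / y)) {(s, t). even (s + t)}"
    by (rule has_sum_reindex_bij_witness[where j = "\<lambda>(m, n). (m + n, m - n)" and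
          i = "\<lambda>(s, t). ((s + t) div 2, (s - t) div 2)"]) (auto simp: term_eq, presburger+)
  finally have lhs: "(sgn has_sum theta p (x * y) * theta p (x / y)) {(s, t). even (s + t)}" .
  let ?E = "{t :: int. even t}" and ?O = "{t :: int. odd t}"
  \<comment> \<open>Since \<open>h\<close> evaluates \<open>b x\<close> at \<open>s - 1\<close>,
    even \<open>s\<close> give the odd half in \<open>x\<close>.\<close>
  have "((\<lambda>(s, t). h s t) has_sum c * (theta_half p ?O x * theta_half p ?E y)) (?E \<times> ?E)"
    using half[of ?O ?E] by simp
  then have even: "(sgn has_sum c * (theta_half p ?O x * theta_half p ?E y)) (?E \<times> ?E)"
    by (subst has_sum_cong[where g = "\<lambda>(s, t). h s t"]) (auto simp: sgn_def)
  have "((\<lambda>(s, t). h s t) has_sum c * (theta_half p ?E x * theta_half p ?O y)) (?O \<times> ?O)"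
    using half[of ?E ?O] by simp
  then have "((\<lambda>z. - (case z of (s, t) \<Rightarrow> h s t)) has_sum
      - (c * (theta_half p ?E x * theta_half p ?O y))) (?O \<times> ?O)"
    by (simp add: has_sum_uminus)
  then have odd: "(sgn has_sum - (c * (theta_half p ?E x * theta_half p ?O y))) (?O \<times> ?O)"
    by (subst has_sum_cong[where g = "\<lambda>z. - (case z of (s, t) \<Rightarrow> h s t)"]) (auto simp: sgn_def)
  have "?E \<times> ?E \<union> ?O \<times> ?O = {(s, t). even (s + t)}"
    by auto
  then have "(sgn has_sum c * (theta_half p ?O x * theta_half p ?E y) +
      - (c * (theta_half p ?E x * theta_half p ?O y))) {(s, t). even (s + t)}"
    using has_sum_Un_disjoint[OF even odd] by fastforce
  from has_sum_unique[OF lhs this] show ?thesis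
    by (simp add: c_def algebra_simps)
qed

text \<open>By \<open>theta_mult_theta\<close> each term is a product of two determinants
  \<open>D\<close>. The two on the left carry the prefactor \<open>c * c * x * u\<close>, the one on
  the right \<open>c * c * y * x\<close>, whence the ratio \<open>u / y\<close>.\<close>

theorem theta_three_term:
  assumes p: "0 < p" "p < 1" and pos: "0 < x" "0 < y" "0 < u" "0 < v"
  shows "theta p (x * y) * theta p (x / y) * theta p (u * v) * theta p (u / v) -
      theta p (x * v) * theta p (x / v) * theta p (u * y) * theta p (u / y) =
    (u / y) * (theta p (y * v) * theta p (y / v) * theta p (x * u) * theta p (x / u))"
proof -
  define c where "c = p powr (- 1 / 4)"
  define D where "D a b = theta_half p {t. odd t} a * theta_half p {t. even t} b -
     theta_half p {t. even t} a * theta_half p {t. odd t} b" for a b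
  have mult: "theta p (a * b) * theta p (a / b) = c * a * D a b" if "0 < a" "0 < b" for a b
    unfolding c_def D_def by (rule theta_mult_theta[OF p that])
  have plucker: "D x y * D u v - D x v * D u y = D y v * D x u"
    by (simp add: D_def algebra_simps)
  have "(theta p (x * y) * theta p (x / y)) * (theta p (u * v) * theta p (u / v)) -
      (theta p (x * v) * theta p (x / v)) * (theta p (u * y) * theta p (u / y)) =
      c * c * x * u * (D x y * D u v - D x v * D u y)"
    unfolding mult[OF pos(1,2)] mult[OF pos(3,4)] mult[OF pos(1,4)] mult[OF pos(3,2)]
    by (simp add: algebra_simps)
  also have "\<dots> = (u / y) * ((c * y * D y v) * (c * x * D x u))"
    unfolding plucker using pos by simp
  also have "\<dots> = (u / y) * ((theta p (y * v) * theta p (y / v)) * (theta p (x * u) * theta p (x / u)))"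
    unfolding mult[OF pos(2,4)] mult[OF pos(1,3)] ..
  finally show ?thesis
    by (simp only: mult.assoc)
qed

subsection \<open>The modulus 68\<close>

text \<open>The window \<open>p < z < 1\<close> makes all factors of both products positive, so the
  limits are positive too.\<close>

lemma theta_pos:
  assumes p: "0 < p" and z: "p < z" "z < 1"
  shows "0 < theta p z"
proof -
  have p1: "p < 1" and z0: "0 < z"
    using p z by linarith+
  have pow: "0 \<le> p ^ k" "p ^ k \<le> 1" for k
    using p p1 by (simp_all add: power_le_one)
  have geo: "summable (\<lambda>k. p ^ k)"
    using p p1 by (simp add: summable_geometric)
  obtain L where L: "0 < L" "qpoch p \<longlonglongrightarrow> L"
    using qpoch_tendsto[OF p p1] .
  have "z * p ^ k < 1" for k
    using mult_left_le[OF pow(2)[of k], of z] z z0 by linarith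
  moreover have "0 \<le> z * p ^ k" for k
    using z0 pow by simp
  ultimately obtain A where A: "0 < A" "(\<lambda>n. \<Prod>k<n. 1 - z * p ^ k) \<longlonglongrightarrow> A"
    using tendsto_prod_one_minus[of "\<lambda>k. z * p ^ k"] geo by (auto simp: summable_mult)
  have "p ^ Suc k < z" for k
    using mult_left_le[OF pow(2)[of k], of p] p z unfolding power_Suc by linarith
  then have "p ^ Suc k / z < 1" for k
    using z0 by (simp add: divide_less_eq)
  moreover have "0 \<le> p ^ Suc k / z" for k
    using z0 p by simp
  moreover have "summable (\<lambda>k. p ^ Suc k / z)"
    using geo by (intro summable_divide) (simp add: summable_mult)
  ultimately obtain B where B: "0 < B" "(\<lambda>n. \<Prod>k<n. 1 - p ^ Suc k / z) \<longlonglongrightarrow> B"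
    using tendsto_prod_one_minus[of "\<lambda>k. p ^ Suc k / z"] by blast
  have "theta_trunc p z \<longlonglongrightarrow> A * B"
    unfolding theta_trunc_def[abs_def] prod.distrib by (rule tendsto_mult[OF A(2) B(2)])
  then have "theta p z / L = A * B"
    using jacobi_triple_product[OF p p1 L z0] LIMSEQ_unique by blast
  then have "theta p z = A * B * L"
    using L by (simp add: field_simps)
  then show ?thesis
    using A B L by simp
qed

section \<open>Products over residue classes\<close>

text \<open>Links truncated theta products to part sizes congruent to \<open>a\<close> or
  \<open>- a\<close> modulo \<open>d\<close>.\<close>

lemma theta_trunc_power:
  fixes q :: real
  assumes "0 < q" "a \<le> d"
  shows "theta_trunc (q ^ d) (q ^ a) N = (\<Prod>k<N. (1 - q ^ (d * k + a)) * (1 - q ^ (d * k + (d - a))))"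
proof -
  have "(q ^ d) ^ Suc k / q ^ a = q ^ (d * k + (d - a))" for k
  proof -
    have "d * Suc k = (d * k + (d - a)) + a"
      using assms by simp
    then have "(q ^ d) ^ Suc k = q ^ (d * k + (d - a)) * q ^ a"
      by (simp only: power_mult[symmetric] power_add[symmetric])
    then show ?thesis
      using assms by simp
  qed
  moreover have "q ^ a * (q ^ d) ^ k = q ^ (d * k + a)" for k
    by (simp add: power_add power_mult)
  ultimately show ?thesis
    by (simp only: theta_trunc_def)
qed

text \<open>Exchanging \<open>a\<close> and \<open>d - a\<close> only swaps the two factors in each
  finite product.\<close>

lemma theta_reflect:
  fixes q :: real
  assumes q: "0 < q" "q < 1" and a: "a \<le> d" "0 < d"
  shows "theta (q ^ d) (q ^ (d - a)) = theta (q ^ d) (q ^ a)"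
proof -
  have p: "0 < q ^ d" "q ^ d < 1"
    using q a power_strict_decreasing[of 0 d q] by simp_all
  obtain L where L: "0 < L" "qpoch (q ^ d) \<longlonglongrightarrow> L"
    using qpoch_tendsto[OF p] .
  have "theta_trunc (q ^ d) (q ^ (d - a)) = theta_trunc (q ^ d) (q ^ a)"
    using q a by (auto simp: theta_trunc_power mult.commute)
  then have "theta (q ^ d) (q ^ (d - a)) / L = theta (q ^ d) (q ^ a) / L"
    using jacobi_triple_product[OF p L] q LIMSEQ_unique by (metis zero_less_power)
  then show ?thesis
    using L by simp
qed

lemma prod_lessThan_mult:
  fixes f :: "nat \<Rightarrow> 'a :: comm_monoid_mult"
  shows "(\<Prod>m<d * N. f m) = (\<Prod>k<N. \<Prod>i<d. f (d * k + i))"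
proof -
  have "(\<Prod>m<a + b. f m) = (\<Prod>m<a. f m) * (\<Prod>i<b. f (a + i))" for a b
    by (induction b) (simp_all add: mult_ac)
  then show ?thesis
    by (induction N) (simp_all add: add.commute[of d])
qed

lemma prod_residues:
  fixes q :: real
  assumes r: "\<And>k i. i < d \<Longrightarrow> r (d * k + i) = r i"
    and S: "S \<subseteq> {..<d}" "\<And>i. i < d \<Longrightarrow> i \<notin> S \<Longrightarrow> r i = 0"
  shows "(\<Prod>m<d * N. (1 - q ^ m) ^ r m) = (\<Prod>k<N. \<Prod>i\<in>S. (1 - q ^ (d * k + i)) ^ r i)"
  unfolding prod_lessThan_mult
proof (rule prod.cong[OF refl])
  fix k
  have "(\<Prod>i<d. (1 - q ^ (d * k + i)) ^ r (d * k + i)) = (\<Prod>i<d. (1 - q ^ (d * k + i)) ^ r i)"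
    by (intro prod.cong refl) (simp add: r)
  also have "\<dots> = (\<Prod>i\<in>S. (1 - q ^ (d * k + i)) ^ r i)"
    using S by (intro prod.mono_neutral_right) auto
  finally show "(\<Prod>i<d. (1 - q ^ (d * k + i)) ^ r (d * k + i)) =
      (\<Prod>i\<in>S. (1 - q ^ (d * k + i)) ^ r i)" .
qed

text \<open>Residues pair off as 1 and 67, 17 and 51, 32 and 36. As 34 is its own mirror image,
  \<open>T 34\<close> already accounts for two colours and appears unsquared.\<close>

lemma prod_colors1:
  fixes q :: real
  assumes "0 < q"
  defines "T \<equiv> \<lambda>a. theta_trunc (q ^ 68) (q ^ a)"
  shows "(\<Prod>m<68 * N. (1 - q ^ m) ^ colors1 m) = T 32 N * T 34 N * (T 1 N)\<^sup>2 * (T 17 N)\<^sup>2"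
proof -
  have "(\<Prod>m<68 * N. (1 - q ^ m) ^ colors1 m) =
      (\<Prod>k<N. \<Prod>i\<in>{1, 17, 32, 34, 36, 51, 67}. (1 - q ^ (68 * k + i)) ^ colors1 i)"
    by (rule prod_residues) (auto simp: colors1_def)
  also have "\<dots> = T 32 N * T 34 N * (T 1 N)\<^sup>2 * (T 17 N)\<^sup>2"
    unfolding T_def using assms(1)
    by (simp add: theta_trunc_power theta_trunc_power[of q 1 68, simplified]
        prod.distrib prod_power_distrib colors1_def power2_eq_square mult_ac)
  finally show ?thesis .
qed

lemma prod_colors2:
  fixes q :: real
  assumes "0 < q"
  defines "T \<equiv> \<lambda>a. theta_trunc (q ^ 68) (q ^ a)"
  shows "(\<Prod>m<68 * N. (1 - q ^ m) ^ colors2 m) = T 32 N * T 34 N * (T 17 N)\<^sup>2 * (T 33 N)\<^sup>2"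
proof -
  have "(\<Prod>m<68 * N. (1 - q ^ m) ^ colors2 m) =
      (\<Prod>k<N. \<Prod>i\<in>{17, 32, 33, 34, 35, 36, 51}. (1 - q ^ (68 * k + i)) ^ colors2 i)"
    by (rule prod_residues) (auto simp: colors2_def)
  also have "\<dots> = T 32 N * T 34 N * (T 17 N)\<^sup>2 * (T 33 N)\<^sup>2"
    unfolding T_def using assms(1)
    by (simp add: theta_trunc_power prod.distrib prod_power_distrib colors2_def power2_eq_square mult_ac)
  finally show ?thesis .
qed

text \<open>The pairs are 1 and 67, 16 and 52, 18 and 50, 33 and 35; those in two colours are
  squared.\<close>

lemma prod_colors3:
  fixes q :: real
  assumes "0 < q"
  defines "T \<equiv> \<lambda>a. theta_trunc (q ^ 68) (q ^ a)"
  shows "(\<Prod>m<68 * N. (1 - q ^ m) ^ colors3 m) = T 16 N * T 18 N * (T 1 N)\<^sup>2 * (T 33 N)\<^sup>2"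
proof -
  have "(\<Prod>m<68 * N. (1 - q ^ m) ^ colors3 m) =
      (\<Prod>k<N. \<Prod>i\<in>{1, 16, 18, 33, 35, 50, 52, 67}. (1 - q ^ (68 * k + i)) ^ colors3 i)"
    by (rule prod_residues) (auto simp: colors3_def)
  also have "\<dots> = T 16 N * T 18 N * (T 1 N)\<^sup>2 * (T 33 N)\<^sup>2"
    unfolding T_def using assms(1)
    by (simp add: theta_trunc_power theta_trunc_power[of q 1 68, simplified]
        prod.distrib prod_power_distrib colors3_def power2_eq_square mult_ac)
  finally show ?thesis .
qed

section \<open>The identity of generating functions\<close>

lemma sums_K_diff:
  fixes q :: real
  assumes q: "0 < q" "q < 1"
  shows "(\<lambda>n. (real (K1 n) + (if 16 \<le> n then real (K2 (n - 16)) else 0) - real (K3 n)) * q ^ n) sums 0"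
proof -
  define p where "p = q ^ 68"
  have p: "0 < p" "p < 1"
    using q by (simp_all add: p_def power_less_one_iff)
  obtain L where L: "0 < L" "qpoch p \<longlonglongrightarrow> L"
    using qpoch_tendsto[OF p] .
  define t where "t a = theta p (q ^ a) / L" for a
  have lim: "theta_trunc p (q ^ a) \<longlonglongrightarrow> t a" for a
    unfolding t_def using jacobi_triple_product[OF p L] q by simp
  \<comment> \<open>For these \<open>a\<close> the argument \<open>q ^ a\<close> lies strictly
    between \<open>p = q ^ 68\<close> and 1.\<close>
  have pos: "0 < t a" if "0 < a" "a < 68" for a
    unfolding t_def using that q L p power_strict_decreasing[of 0 a q] power_strict_decreasing[of a 68 q]
    by (intro divide_pos_pos theta_pos) (simp_all add: p_def)
  have K1: "(\<lambda>n. real (K1 n) * q ^ n) sums (1 / (t 32 * t 34 * (t 1)\<^sup>2 * (t 17)\<^sup>2))"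
  proof -
    have "(\<lambda>N. \<Prod>m<68 * N. (1 - q ^ m) ^ colors1 m) \<longlonglongrightarrow> t 32 * t 34 * (t 1)\<^sup>2 * (t 17)\<^sup>2"
      unfolding prod_colors1[OF q(1)] p_def[symmetric] by (intro tendsto_mult tendsto_power lim)
    then show ?thesis
      unfolding K1_def by (rule sums_card_colored_partitions[OF q, rotated -1])
        (simp add: colors1_def, simp, intro mult_pos_pos zero_less_power pos, simp_all)
  qed
  have K2: "(\<lambda>n. real (K2 n) * q ^ n) sums (1 / (t 32 * t 34 * (t 17)\<^sup>2 * (t 33)\<^sup>2))"
  proof -
    have "(\<lambda>N. \<Prod>m<68 * N. (1 - q ^ m) ^ colors2 m) \<longlonglongrightarrow> t 32 * t 34 * (t 17)\<^sup>2 * (t 33)\<^sup>2"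
      unfolding prod_colors2[OF q(1)] p_def[symmetric] by (intro tendsto_mult tendsto_power lim)
    then show ?thesis
      unfolding K2_def by (rule sums_card_colored_partitions[OF q, rotated -1])
        (simp add: colors2_def, simp, intro mult_pos_pos zero_less_power pos, simp_all)
  qed
  have K3: "(\<lambda>n. real (K3 n) * q ^ n) sums (1 / (t 16 * t 18 * (t 1)\<^sup>2 * (t 33)\<^sup>2))"
  proof -
    have "(\<lambda>N. \<Prod>m<68 * N. (1 - q ^ m) ^ colors3 m) \<longlonglongrightarrow> t 16 * t 18 * (t 1)\<^sup>2 * (t 33)\<^sup>2"
      unfolding prod_colors3[OF q(1)] p_def[symmetric] by (intro tendsto_mult tendsto_power lim)
    then show ?thesis
      unfolding K3_def by (rule sums_card_colored_partitions[OF q, rotated -1])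
        (simp add: colors3_def, simp, intro mult_pos_pos zero_less_power pos, simp_all)
  qed
  have "(\<lambda>n. real (K2 n) * q ^ (n + 16)) sums (q ^ 16 * (1 / (t 32 * t 34 * (t 17)\<^sup>2 * (t 33)\<^sup>2)))"
    using sums_mult[OF K2, of "q ^ 16"] by (simp add: power_add mult_ac)
  \<comment> \<open>The value 0 below 16 makes multiplication by \<open>q ^ 16\<close> a shift of
    coefficients.\<close>
  then have K2': "(\<lambda>n. (if 16 \<le> n then real (K2 (n - 16)) else 0) * q ^ n) sums
      (q ^ 16 * (1 / (t 32 * t 34 * (t 17)\<^sup>2 * (t 33)\<^sup>2)))"
    by (subst sums_zero_iff_shift[of 16, symmetric]) auto
  have theta_eq: "theta p (q ^ a) = L * t a" for a
    using L by (simp add: t_def)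
  have div: "q ^ (a + b) / q ^ b = q ^ a" for a b
    using q by (simp add: power_add)
  \<comment> \<open>In \<open>theta_three_term\<close> the choice \<open>v = 1\<close> produces the
    repeated factors, and \<open>u / y\<close> and \<open>x / u\<close> both equal
    \<open>q ^ 16\<close>.\<close>
  have "theta p (q ^ 34) * theta p (q ^ 32) * theta p (q ^ 17) * theta p (q ^ 17) -
      theta p (q ^ 33) * theta p (q ^ 33) * theta p (q ^ 18) * theta p (q ^ 16) =
      q ^ 16 * (theta p (q ^ 1) * theta p (q ^ 1) * theta p (q ^ 50) * theta p (q ^ 16))"
    using theta_three_term[OF p, of "q ^ 33" "q ^ 1" "q ^ 17" 1] q div[of 32 1] div[of 16 1] div[of 16 17]
    by (simp only: power_add[symmetric]) (simp del: times_divide_eq_left)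
  moreover have "theta p (q ^ 50) = theta p (q ^ 18)"
    using theta_reflect[OF q, of 18 68] by (simp add: p_def)
  \<comment> \<open>Every product has four thetas, so passing to \<open>t\<close> costs the common
    factor \<open>L ^ 4\<close>.\<close>
  ultimately have "L ^ 4 * (t 34 * t 32 * (t 17)\<^sup>2 - (t 33)\<^sup>2 * t 18 * t 16) =
      L ^ 4 * (q ^ 16 * ((t 1)\<^sup>2 * t 18 * t 16))"
    unfolding theta_eq by (simp add: algebra_simps power2_eq_square power4_eq_xxxx)
  then have key: "t 34 * t 32 * (t 17)\<^sup>2 - (t 33)\<^sup>2 * t 18 * t 16 = q ^ 16 * ((t 1)\<^sup>2 * t 18 * t 16)"
    using L by simp
  \<comment> \<open>Over the common denominator the numerator is the difference of the two sides of
    \<open>key\<close>.\<close>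
  have "1 / (t 32 * t 34 * (t 1)\<^sup>2 * (t 17)\<^sup>2) + q ^ 16 * (1 / (t 32 * t 34 * (t 17)\<^sup>2 * (t 33)\<^sup>2)) -
      1 / (t 16 * t 18 * (t 1)\<^sup>2 * (t 33)\<^sup>2) =
      ((t 33)\<^sup>2 * t 18 * t 16 + q ^ 16 * ((t 1)\<^sup>2 * t 18 * t 16) - t 34 * t 32 * (t 17)\<^sup>2) /
      (t 16 * t 18 * t 32 * t 34 * (t 1)\<^sup>2 * (t 17)\<^sup>2 * (t 33)\<^sup>2)"
    using pos[of 1] pos[of 16] pos[of 17] pos[of 18] pos[of 32] pos[of 33] pos[of 34]
    by (simp add: divide_simps) (simp add: algebra_simps)
  also have "\<dots> = 0"
    unfolding key[symmetric] by simp
  finally show ?thesis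
    using sums_diff[OF sums_add[OF K1 K2'] K3] by (simp only: distrib_right left_diff_distrib)
qed

theorem theorem4p2:
  fixes n :: nat
  assumes "n \<ge> 16"
  shows "K1 n + K2 (n - 16) = K3 n"
proof -
  have "real (K1 n) + (if 16 \<le> n then real (K2 (n - 16)) else 0) - real (K3 n) = 0"
    by (rule powser_eq_0_at_right_imp_coeff_eq_0) (rule sums_K_diff)
  then have "real (K1 n + K2 (n - 16)) = real (K3 n)"
    using assms by simp
  then show ?thesis
    by (simp only: of_nat_eq_iff)
qed

end
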